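(* Let $(G,F,\mathcal{C})$ be a framework, and let $e,f_1,f_2\in E(G)$ be distinct. If $e,f_1$ are twinned then $e,f_2$ are not twinned.
   Context: All graphs are finite and simple; paths and circuits have no repeated vertices. The ends of a path are its first and last vertices, its end-edges its first and last edges. For a set of edges $E'$, $G\setminus E'$ is obtained from $G$ by deleting those edges (keeping all vertices). For a path or circuit $C$, a sequence of vertices/edges is "in order" in $C$ if they are met in that order traversing $C$ (from one end if $C$ is a path; from some starting point if $C$ is a circuit). A framework is a triple $(G,F,\mathcal{C})$ where $G$ is cubic, $F$ is a subgraph of $G$, and $\mathcal{C}$ is a set of subgraphs of $G\setminus E(F)$, satisfying (F1)–(F7) below. Distinct edges $e,f$ are twinned if there exist distinct $C_1,C_2\in\mathcal{C}$ with $e,f\in E(C_1\cap C_2)$. (F1) Each member of $\mathcal{C}$ is an induced subgraph of $G\setminus E(F)$, has at least three edges, and is a path or a circuit. (F2) Every edge of $G\setminus E(F)$ belongs to some member of $\mathcal{C}$, and for every two edges $e,f$ of $G$ with a common end not in $V(F)$ there exists $C\in\mathcal{C}$ with $e,f\in E(C)$. (F3) If $C_1,C_2\in\mathcal{C}$ are distinct and $v\in V(C_1\cap C_2)$, then either $V(C_1\cap C_2)=\{v\}$, or $v$ is incident with an edge of $C_1\cap C_2$, or $v\in V(F)$. (F4) If $C_1\in\mathcal{C}$ is a path, every member of $\mathcal{C}$ containing an end-edge of $C_1$ is a path; and if $C_2\in\mathcal{C}\setminus\{C_1\}$ is also a path, then every component of $C_1\cap C_2$ contains an end of $C_1$, and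 every edge of $C_1\cap C_2$ is an end-edge of $C_1$. (F5) If $C\in\mathcal{C}$ is a circuit then $|V(C\cap F)|\le 1$ and every vertex of $C\cap F$ has degree 1 in $F$; if $C\in\mathcal{C}$ is a path then every vertex of $C\cap F$ is an end of $C$ and has degree 0 or 2 in $F$. (F6) If $e,f$ are twinned and $C\in\mathcal{C}$ with $e\in E(C)$, then $|V(C)|\le 6$ and either: $f\in E(C)$, $C$ is a circuit, $e,f$ have a common end in $V(F)$, and no path in $\mathcal{C}$ contains any vertex of $e$ or $f$; or $f\in E(C)$, $C$ is a path with end-edges $e,f$, and $C\cap F$ is null; or $f\notin E(C)$, $C$ is a path with $|E(C)|=3$, $e$ is an end-edge of $C$, and no end of $e$ is in $V(F)$. (F7) Let $C\in\mathcal{C}$ be a path of length five with twinned end-edges $e,f$. Then $|E(C')|\le 4$ for every path $C'\in\mathcal{C}\setminus\{C\}$ containing $e$. Moreover, let $C$ have vertices $v_0,v_1,\dots,v_5$ in order; then there exists $C'\in\mathcal{C}$ with end-edges $e$ and $f$ and with ends $v_0$ and $v_4$. *)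

theory Defs
  imports Main
begin

datatype 'a graph = Graph (verts: "'a set") (edges: "'a set set")

text \<open>Edges are two-element vertex sets, so loops and parallel edges cannot occur.
  The null graph is allowed.\<close>

definition simple_graph :: "'a graph \<Rightarrow> bool" where
  "simple_graph G \<longleftrightarrow> finite (verts G) \<and> (\<forall>e \<in> edges G. e \<subseteq> verts G \<and> card e = 2)"

definition subgraph :: "'a graph \<Rightarrow> 'a graph \<Rightarrow> bool" where
  "subgraph H G \<longleftrightarrow>
     simple_graph H \<and> simple_graph G \<and> verts H \<subseteq> verts G \<and> edges H \<subseteq> edges G"

definition induced_subgraph :: "'a graph \<Rightarrow> 'a graph \<Rightarrow> bool" where
  "induced_subgraph H G \<longleftrightarrow> subgraph H G \<and> edges H = {e \<in> edges G. e \<subseteq> verts H}"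

definition graph_inter :: "'a graph \<Rightarrow> 'a graph \<Rightarrow> 'a graph" where
  "graph_inter G H = Graph (verts G \<inter> verts H) (edges G \<inter> edges H)"

definition delete_edges :: "'a graph \<Rightarrow> 'a set set \<Rightarrow> 'a graph" where
  "delete_edges G X = Graph (verts G) (edges G - X)"

definition null_graph :: "'a graph \<Rightarrow> bool" where
  "null_graph G \<longleftrightarrow> verts G = {}"

definition degree :: "'a graph \<Rightarrow> 'a \<Rightarrow> nat" where
  "degree G v = card {e \<in> edges G. v \<in> e}"

definition cubic :: "'a graph \<Rightarrow> bool" where
  "cubic G \<longleftrightarrow> simple_graph G \<and> (\<forall>v \<in> verts G. degree G v = 3)"

text \<open>\<open>path_order P vs\<close>: the graph \<open>P\<close> is a path and \<open>vs\<close> lists its vertices in order, from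
  one of its ends. Each path has exactly one such list up to reversal. A single vertex is a
  path.\<close>

definition path_order :: "'a graph \<Rightarrow> 'a list \<Rightarrow> bool" where
  "path_order P vs \<longleftrightarrow>
     vs \<noteq> [] \<and> distinct vs \<and> verts P = set vs \<and>
     edges P = {{vs ! i, vs ! Suc i} | i. Suc i < length vs}"

definition is_path :: "'a graph \<Rightarrow> bool" where
  "is_path P \<longleftrightarrow> (\<exists>vs. path_order P vs)"

definition is_circuit :: "'a graph \<Rightarrow> bool" where
  "is_circuit C \<longleftrightarrow>
     (\<exists>vs. length vs \<ge> 3 \<and> distinct vs \<and> verts C = set vs \<and>
        edges C = {{vs ! i, vs ! Suc i} | i. Suc i < length vs} \<union> {{last vs, hd vs}})"

definition path_ends :: "'a graph \<Rightarrow> 'a set" where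
  "path_ends P = {v. \<exists>vs. path_order P vs \<and> (v = hd vs \<or> v = last vs)}"

definition path_end_edges :: "'a graph \<Rightarrow> 'a set set" where
  "path_end_edges P =
     {e. \<exists>vs. path_order P vs \<and> length vs \<ge> 2 \<and>
        (e = {vs ! 0, vs ! 1} \<or> e = {vs ! (length vs - 2), vs ! (length vs - 1)})}"

definition connected_graph :: "'a graph \<Rightarrow> bool" where
  "connected_graph G \<longleftrightarrow> verts G \<noteq> {} \<and>
     (\<forall>u \<in> verts G. \<forall>v \<in> verts G.
        \<exists>P vs. subgraph P G \<and> path_order P vs \<and> hd vs = u \<and> last vs = v)"

definition is_component :: "'a graph \<Rightarrow> 'a graph \<Rightarrow> bool" where
  "is_component H G \<longleftrightarrow>
     subgraph H G \<and> connected_graph H \<and>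
     (\<forall>K. subgraph K G \<and> connected_graph K \<and> subgraph H K \<longrightarrow> K = H)"

definition twinned :: "'a graph set \<Rightarrow> 'a set \<Rightarrow> 'a set \<Rightarrow> bool" where
  "twinned \<C> e f \<longleftrightarrow> e \<noteq> f \<and>
     (\<exists>C1 \<in> \<C>. \<exists>C2 \<in> \<C>. C1 \<noteq> C2 \<and> e \<in> edges (graph_inter C1 C2) \<and> f \<in> edges (graph_inter C1 C2))"

locale framework =
  fixes G F :: "'a graph" and \<C> :: "'a graph set"
  assumes cubic_G: "cubic G"
    and F_subgraph: "subgraph F G"
    and C_subgraph: "\<forall>C \<in> \<C>. subgraph C (delete_edges G (edges F))"
    and F1: "\<forall>C \<in> \<C>. induced_subgraph C (delete_edges G (edges F)) \<and>
      card (edges C) \<ge> 3 \<and> (is_path C \<or> is_circuit C)"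
    and F2: "(\<forall>e \<in> edges (delete_edges G (edges F)). \<exists>C \<in> \<C>. e \<in> edges C) \<and>
      (\<forall>e \<in> edges G. \<forall>f \<in> edges G. e \<noteq> f \<and> (\<exists>v. v \<in> e \<and> v \<in> f \<and> v \<notin> verts F) \<longrightarrow>
         (\<exists>C \<in> \<C>. e \<in> edges C \<and> f \<in> edges C))"
    and F3: "\<forall>C1 \<in> \<C>. \<forall>C2 \<in> \<C>. C1 \<noteq> C2 \<longrightarrow>
      (\<forall>v \<in> verts (graph_inter C1 C2).
         verts (graph_inter C1 C2) = {v} \<or>
         (\<exists>e \<in> edges (graph_inter C1 C2). v \<in> e) \<or>
         v \<in> verts F)"
    and F4: "\<forall>C1 \<in> \<C>. is_path C1 \<longrightarrow>
      (\<forall>D \<in> \<C>. edges D \<inter> path_end_edges C1 \<noteq> {} \<longrightarrow> is_path D) \<and>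
      (\<forall>C2 \<in> \<C> - {C1}. is_path C2 \<longrightarrow>
         (\<forall>H. is_component H (graph_inter C1 C2) \<longrightarrow> verts H \<inter> path_ends C1 \<noteq> {}) \<and>
         edges (graph_inter C1 C2) \<subseteq> path_end_edges C1)"
    and F5: "\<forall>C \<in> \<C>.
      (is_circuit C \<longrightarrow> card (verts (graph_inter C F)) \<le> 1 \<and>
         (\<forall>v \<in> verts (graph_inter C F). degree F v = 1)) \<and>
      (is_path C \<longrightarrow>
         (\<forall>v \<in> verts (graph_inter C F). v \<in> path_ends C \<and> (degree F v = 0 \<or> degree F v = 2)))"
    and F6: "\<forall>e f. twinned \<C> e f \<longrightarrow> (\<forall>C \<in> \<C>. e \<in> edges C \<longrightarrow>
      card (verts C) \<le> 6 \<and>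
      (f \<in> edges C \<and> is_circuit C \<and> (\<exists>v. v \<in> e \<and> v \<in> f \<and> v \<in> verts F) \<and>
         (\<forall>P \<in> \<C>. is_path P \<longrightarrow> verts P \<inter> (e \<union> f) = {}) \<or>
       f \<in> edges C \<and> is_path C \<and> path_end_edges C = {e, f} \<and> null_graph (graph_inter C F) \<or>
       f \<notin> edges C \<and> is_path C \<and> card (edges C) = 3 \<and> e \<in> path_end_edges C \<and>
         e \<inter> verts F = {}))"
    and F7: "\<forall>C \<in> \<C>. \<forall>e f. is_path C \<and> card (edges C) = 5 \<and>
        path_end_edges C = {e, f} \<and> twinned \<C> e f \<longrightarrow>
      (\<forall>C' \<in> \<C> - {C}. is_path C' \<and> e \<in> edges C' \<longrightarrow> card (edges C') \<le> 4) \<and>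
      (\<forall>v0 v1 v2 v3 v4 v5. path_order C [v0, v1, v2, v3, v4, v5] \<longrightarrow>
         (\<exists>C' \<in> \<C>. is_path C' \<and> path_end_edges C' = {e, f} \<and> path_ends C' = {v0, v4}))"

end

(* If e is twinned with both f1 and f2, take distinct C1, C2 containing e and f1.  By (F6) either
   C1 is a circuit, and then e, f1, f2 and the edge of F at the unique vertex of C1 in F are four
   edges of the cubic graph G at one vertex; or C1 and C2 are three-edge paths with end-edges e
   and f1, and then they are induced subgraphs on the same four vertices, hence equal. *)

theory Submission
  imports Defs
begin

lemma path_order_card_edges:
  assumes "path_order P vs"
  shows "card (edges P) = length vs - 1"
proof -
  have d: "distinct vs" and
    e: "edges P = (\<lambda>i. {vs ! i, vs ! Suc i}) ` {..<length vs - 1}"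
    using assms by (auto simp: path_order_def)
  have "inj_on (\<lambda>i. {vs ! i, vs ! Suc i}) {..<length vs - 1}"
    using d by (auto simp: inj_on_def doubleton_eq_iff nth_eq_iff_index_eq)
  then show ?thesis
    by (simp add: e card_image)
qed

text \<open>Three edges mean four vertices \<open>a, b, c, d\<close>, and the end-edges
  \<open>{a, b}\<close> and \<open>{c, d}\<close> already cover them. A longer path would have an
  inner vertex on neither end-edge.\<close>

lemma verts_subset_Union_path_end_edges:
  assumes "is_path P" and "card (edges P) = 3"
  shows "verts P \<subseteq> \<Union> (path_end_edges P)"
proof -
  from assms(1) obtain vs where vs: "path_order P vs"
    by (auto simp: is_path_def)
  have "length vs = 4"
    using assms(2) path_order_card_edges[OF vs] by simp
  then obtain a b c d where abcd: "vs = [a, b, c, d]"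
    by (auto simp: length_Suc_conv numeral_eq_Suc)
  have "{a, b} \<in> path_end_edges P" "{c, d} \<in> path_end_edges P"
    unfolding path_end_edges_def using vs abcd by force+
  moreover have "verts P = {a, b} \<union> {c, d}"
    using vs abcd by (auto simp: path_order_def)
  ultimately show ?thesis
    by blast
qed

context framework
begin

lemma edge_subset_verts:
  assumes "C \<in> \<C>" and "e \<in> edges C"
  shows "e \<subseteq> verts C"
  using C_subgraph assms by (auto simp: subgraph_def simple_graph_def)

text \<open>By (F1) both are induced subgraphs of the same graph, so the vertex set determines the
  edges.\<close>

lemma eq_if_verts_eq:
  assumes "C \<in> \<C>" and "D \<in> \<C>" and "verts C = verts D"
  shows "C = D"
  using F1 assms by (intro graph.expand) (auto simp: induced_subgraph_def)

lemma three_edge_path_verts: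
  assumes "C \<in> \<C>" "is_path C" "card (edges C) = 3" "path_end_edges C = {e, f}"
    and "e \<in> edges C" "f \<in> edges C"
  shows "verts C = e \<union> f"
proof
  show "verts C \<subseteq> e \<union> f"
    using verts_subset_Union_path_end_edges[OF assms(2,3)] by (simp add: assms(4))
  show "e \<union> f \<subseteq> verts C"
    using edge_subset_verts[OF assms(1)] assms(5,6) by simp
qed

text \<open>By (F5) one of the three edges of \<open>G\<close> at \<open>v\<close> lies in
  \<open>F\<close>, and \<open>C\<close> avoids the edges of \<open>F\<close>, so only two are left
  for \<open>X\<close>. Nonemptiness of \<open>X\<close> places \<open>v\<close> on
  \<open>C\<close>, as (F5) requires.\<close>

lemma circuit_edges_at_F_vertex:
  assumes C: "C \<in> \<C>" "is_circuit C" and X: "X \<subseteq> edges C" "\<forall>e \<in> X. v \<in> e" "X \<noteq> {}"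
    and v: "v \<in> verts F"
  shows "card X \<le> 2"
proof -
  have sub: "edges C \<subseteq> edges G - edges F"
    using C_subgraph C(1) by (auto simp: subgraph_def delete_edges_def)
  have "v \<in> verts C"
    using X edge_subset_verts[OF C(1)] by blast
  then have "degree F v = 1"
    using F5 C v by (auto simp: graph_inter_def)
  have "finite (edges G)"
  proof (rule finite_subset)
    show "edges G \<subseteq> Pow (verts G)" "finite (Pow (verts G))"
      using cubic_G by (auto simp: cubic_def simple_graph_def)
  qed
  then have fin: "finite {e \<in> edges G. v \<in> e}"
    by simp
  have inc: "X \<union> {e \<in> edges F. v \<in> e} \<subseteq> {e \<in> edges G. v \<in> e}"
    using F_subgraph sub X by (auto simp: subgraph_def)
  have "card X + degree F v = card (X \<union> {e \<in> edges F. v \<in> e})"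
    unfolding degree_def using sub X(1) finite_subset[OF inc fin]
    by (intro card_Un_disjoint[symmetric]) auto
  also have "\<dots> \<le> degree G v"
    unfolding degree_def by (rule card_mono[OF fin inc])
  also have "\<dots> = 3"
    using cubic_G F_subgraph v by (auto simp: cubic_def subgraph_def)
  finally show ?thesis
    using \<open>degree F v = 1\<close> by simp
qed

lemma circuit_F_vertex_unique:
  assumes "C \<in> \<C>" "is_circuit C" "u \<in> verts C \<inter> verts F" "v \<in> verts C \<inter> verts F"
  shows "u = v"
proof -
  have "finite (verts F)"
    using F_subgraph by (simp add: subgraph_def simple_graph_def)
  moreover have "card (verts C \<inter> verts F) \<le> Suc 0"
    using F5 assms by (auto simp: graph_inter_def)
  ultimately show ?thesis
    using assms(3,4) card_le_Suc0_iff_eq[of "verts C \<inter> verts F"] by blast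
qed

lemma twin_unique:
  assumes tw1: "twinned \<C> e f1" and tw2: "twinned \<C> e f2"
  shows "f1 = f2"
proof (rule ccontr)
  assume ne: "f1 \<noteq> f2"
  obtain C1 C2 where C: "C1 \<in> \<C>" "C2 \<in> \<C>" "C1 \<noteq> C2" "e \<noteq> f1"
    and eC: "e \<in> edges C1" "e \<in> edges C2" and fC: "f1 \<in> edges C1" "f1 \<in> edges C2"
    using tw1 by (auto simp: twinned_def graph_inter_def)
  have "e \<noteq> f2"
    using tw2 by (simp add: twinned_def)
  have "card e = 2"
    using C_subgraph C(1) eC(1) by (auto simp: subgraph_def simple_graph_def)
  then have "e \<noteq> {}"
    by auto
  \<comment> \<open>This refutes the circuit alternative of (F6) once some path through
    \<open>e\<close> is known: that path would meet \<open>e\<close>.\<close>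
  have no_path: "\<not> is_path D'"
    if "\<forall>P \<in> \<C>. is_path P \<longrightarrow> verts P \<inter> (e \<union> f) = {}" "D' \<in> \<C>" "e \<in> edges D'" for f D'
    using that \<open>e \<noteq> {}\<close> edge_subset_verts[of D' e] by blast
  note twin1 = F6[rule_format, OF tw1] and twin2 = F6[rule_format, OF tw2]
  show False
  proof (cases "is_path C1")
    case False
    obtain u where u: "u \<in> e" "u \<in> f1" "u \<in> verts F" and circ: "is_circuit C1"
      using twin1[OF C(1) eC(1)] False by blast
    \<comment> \<open>The only alternative of (F6) open to a non-path also forces \<open>f2\<close>
      into \<open>C1\<close>, although \<open>C1\<close> was chosen for \<open>f1\<close>
      alone.\<close>
    obtain v where v: "v \<in> e" "v \<in> f2" "v \<in> verts F" and f2: "f2 \<in> edges C1"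
      using twin2[OF C(1) eC(1)] False by blast
    \<comment> \<open>Both are ends of \<open>e\<close>, hence vertices of the circuit
      \<open>C1\<close> in \<open>F\<close>.\<close>
    have "u = v"
      using circuit_F_vertex_unique[OF C(1) circ] u v edge_subset_verts[OF C(1) eC(1)] by blast
    then have "card {e, f1, f2} \<le> 2"
      using circuit_edges_at_F_vertex[OF C(1) circ, of "{e, f1, f2}" v] u v eC fC f2 by simp
    then show False
      using ne \<open>e \<noteq> f1\<close> \<open>e \<noteq> f2\<close> by simp
  next
    case True
    have short: "is_path D \<and> card (edges D) = 3 \<and> path_end_edges D = {e, f1}"
      if D: "D \<in> \<C>" "e \<in> edges D" "f1 \<in> edges D" for D
    proof -
      \<comment> \<open>The path \<open>C1\<close> through \<open>e\<close> excludes the circuit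
        alternative for \<open>D\<close>, and \<open>f1\<close> in \<open>D\<close> excludes the
        third.\<close>
      have ends: "is_path D" "path_end_edges D = {e, f1}"
        using twin1[OF D(1,2)] no_path[of f1 C1] True C(1) eC(1) D(3) by blast+
      \<comment> \<open>For the pair \<open>e, f2\<close> this excludes the second alternative of
        (F6), and \<open>D\<close> being a path excludes the first. The third bounds
        \<open>D\<close> to three edges.\<close>
      moreover have "path_end_edges D \<noteq> {e, f2}"
        using ends(2) ne \<open>e \<noteq> f1\<close> by auto
      ultimately show ?thesis
        using twin2[OF D(1,2)] no_path[of f2 D] D by blast
    qed
    have "verts D = e \<union> f1" if D: "D \<in> \<C>" "e \<in> edges D" "f1 \<in> edges D" for D
      using three_edge_path_verts[of D e f1] short[OF D] D by simp
    then have "C1 = C2"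
      using eq_if_verts_eq[OF C(1,2)] C(1,2) eC fC by simp
    then show False
      using C(3) by simp
  qed
qed

end

theorem theorem3p4:
  fixes G F :: "'a graph" and \<C> :: "'a graph set" and e f1 f2 :: "'a set"
  assumes "framework G F \<C>"
    and "e \<in> edges G" and "f1 \<in> edges G" and "f2 \<in> edges G"
    and "e \<noteq> f1" and "e \<noteq> f2" and "f1 \<noteq> f2"
    and "twinned \<C> e f1"
  shows "\<not> twinned \<C> e f2"
  using framework.twin_unique[OF assms(1,8)] assms(7) by blast

end
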